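(* Let $\mathcal{R}$ be a $2$-torsion free commutative ring with unity ($1\neq 0$) and let $(X,\leqslant)$ be a finite pre-ordered set. Then every commuting map $\theta$ of the incidence algebra $I(X,\mathcal{R})$ is proper if and only if, for each connected component $X_0$ of $X$, the set $\mathfrak{D}(X_0)=\{(x,y)\in X_0\times X_0\mid x<y\}$ of all directed edges associated with $X_0$ forms one equivalence class under the relation $\cong$ (that is, any two elements of $\mathfrak{D}(X_0)$ are related by $\cong$; this is regarded as satisfied when $\mathfrak{D}(X_0)$ is empty).
   Context: Pre-order: a reflexive and transitive binary relation. A ring is $2$-torsion free if $2r=0$ implies $r=0$. Incidence algebra: for a locally finite pre-ordered set $X$ (for all $x\leqslant y$ there are only finitely many $z$ with $x\leqslant z\leqslant y$; automatic if $X$ is finite), $I(X,\mathcal{R})=\{f:X\times X\to\mathcal{R}\mid f(x,y)=0 \text{ if } x\not\leqslant y\}$ with pointwise $\mathcal{R}$-module structure and product $(fg)(x,y)=\sum_{x\leqslant z\leqslant y}f(x,z)g(z,y)$. Commuting maps: for an associative $\mathcal{R}$-algebra $A$ with center $Z(A)$ and $[x,y]=xy-yx$, an $\mathcal{R}$-linear map $\theta:A\to A$ is a commuting map if $[\theta(x),x]=0$ for all $x\in A$. It is proper if there are $\lambda\in Z(A)$ and an $\mathcal{R}$-linear map $\mu:A\to A$ with image in $Z(A)$ such that $\theta(x)=\lambda x+\mu(x)$ for all $x\in A$. Order notation: $x<y$ means $x\leqslant y$ and $x\neq y$ (both $x<y$ and $y<x$ may hold, since $\leqslant$ is only a pre-order).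 Write $x\sim y$ if $x\leqslant y$ or $y\leqslant x$. $X$ is connected if any two of its elements can be joined by a finite sequence in which consecutive elements are related by $\sim$; connected components are the maximal connected subsets. Relation $\cong$: let $x_1,\dots,x_n$ ($n\geq 2$) be $n$ different elements of $X$. They form a circle if $x_1\sim x_2$ when $n=2$, and if $x_1\sim x_2,\ x_2\sim x_3,\dots,x_{n-1}\sim x_n,\ x_n\sim x_1$ when $n\geq 3$. The circle contains $x\sim y$ if $x,y$ are (in some order) two cyclically consecutive vertices of it. For $(x,y),(u,v)$ in the set $\mathfrak{D}=\{(x,y)\in X\times X\mid x<y\}$, define $(x,y)\cong(u,v)$ if and only if there is a circle containing both $x\sim y$ and $u\sim v$. This is an equivalence relation on $\mathfrak{D}$. *)

theory Defs
  imports Main "HOL-Library.FuncSet" "HOL-Library.Function_Algebras"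
begin

text \<open>
  A pre-ordered set is a carrier \<open>X\<close> with a relation \<open>r\<close> satisfying \<^term>\<open>preorder_on X r\<close>;
  \<open>(x, y) \<in> r\<close> reads \<open>x \<le> y\<close>, and \<open>r \<subseteq> X \<times> X\<close> is part of \<^const>\<open>preorder_on\<close>.
\<close>

type_synonym ('a, 'r) incfun = "'a \<times> 'a \<Rightarrow> 'r"

text \<open>
  Functions \<open>X \<times> X \<rightarrow> \<R>\<close> are represented by total functions vanishing outside \<open>r\<close>, in particular
  outside \<open>X \<times> X\<close>. Addition, subtraction and zero are the pointwise library operations. The
  library's \<open>*\<close> on functions is also pointwise, so it is not the product of the algebra; that
  product is \<open>inc_mult\<close>, whose sum ranges over a finite set when \<open>X\<close> is finite.
\<close>

definition incidence_algebra :: "'a rel \<Rightarrow> ('a, 'r::comm_ring_1) incfun set" where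
  "incidence_algebra r = {f. \<forall>x y. (x, y) \<notin> r \<longrightarrow> f (x, y) = 0}"

definition inc_scale :: "'r::comm_ring_1 \<Rightarrow> ('a, 'r) incfun \<Rightarrow> ('a, 'r) incfun" where
  "inc_scale c f = (\<lambda>p. c * f p)"

definition inc_mult ::
  "'a rel \<Rightarrow> ('a, 'r::comm_ring_1) incfun \<Rightarrow> ('a, 'r) incfun \<Rightarrow> ('a, 'r) incfun" where
  "inc_mult r f g = (\<lambda>(x, y). \<Sum>z | (x, z) \<in> r \<and> (z, y) \<in> r. f (x, z) * g (z, y))"

definition inc_commutator ::
  "'a rel \<Rightarrow> ('a, 'r::comm_ring_1) incfun \<Rightarrow> ('a, 'r) incfun \<Rightarrow> ('a, 'r) incfun" where
  "inc_commutator r f g = inc_mult r f g - inc_mult r g f"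

definition inc_center :: "'a rel \<Rightarrow> ('a, 'r::comm_ring_1) incfun set" where
  "inc_center r =
    {f \<in> incidence_algebra r. \<forall>g \<in> incidence_algebra r. inc_mult r f g = inc_mult r g f}"

definition inc_linear ::
  "'a rel \<Rightarrow> (('a, 'r::comm_ring_1) incfun \<Rightarrow> ('a, 'r) incfun) \<Rightarrow> bool" where
  "inc_linear r \<theta> \<longleftrightarrow>
     \<theta> \<in> incidence_algebra r \<rightarrow> incidence_algebra r \<and>
     (\<forall>f \<in> incidence_algebra r. \<forall>g \<in> incidence_algebra r. \<theta> (f + g) = \<theta> f + \<theta> g) \<and>
     (\<forall>c. \<forall>f \<in> incidence_algebra r. \<theta> (inc_scale c f) = inc_scale c (\<theta> f))"

definition commuting_map ::
  "'a rel \<Rightarrow> (('a, 'r::comm_ring_1) incfun \<Rightarrow> ('a, 'r) incfun) \<Rightarrow> bool" where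
  "commuting_map r \<theta> \<longleftrightarrow>
     inc_linear r \<theta> \<and> (\<forall>f \<in> incidence_algebra r. inc_commutator r (\<theta> f) f = 0)"

definition proper_map ::
  "'a rel \<Rightarrow> (('a, 'r::comm_ring_1) incfun \<Rightarrow> ('a, 'r) incfun) \<Rightarrow> bool" where
  "proper_map r \<theta> \<longleftrightarrow>
     (\<exists>l \<in> inc_center r. \<exists>\<mu>. inc_linear r \<mu> \<and> \<mu> \<in> incidence_algebra r \<rightarrow> inc_center r \<and>
        (\<forall>f \<in> incidence_algebra r. \<theta> f = inc_mult r l f + \<mu> f))"

definition comparable :: "'a rel \<Rightarrow> 'a \<Rightarrow> 'a \<Rightarrow> bool" where
  "comparable r x y \<longleftrightarrow> (x, y) \<in> r \<or> (y, x) \<in> r"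

text \<open>The joining sequences are required to stay inside the subset \<open>C\<close> itself.\<close>

definition connected_subset :: "'a rel \<Rightarrow> 'a set \<Rightarrow> bool" where
  "connected_subset r C \<longleftrightarrow>
     (\<forall>x \<in> C. \<forall>y \<in> C. (x, y) \<in> {(u, v). u \<in> C \<and> v \<in> C \<and> comparable r u v}\<^sup>*)"

definition connected_components :: "'a set \<Rightarrow> 'a rel \<Rightarrow> 'a set set" where
  "connected_components X r =
     {C. C \<subseteq> X \<and> connected_subset r C \<and>
         (\<forall>D. C \<subseteq> D \<and> D \<subseteq> X \<and> connected_subset r D \<longrightarrow> D = C)}"

text \<open>
  Both \<open>(x, y)\<close> and \<open>(y, x)\<close> may be directed edges: \<open>x < y\<close> means \<open>x \<le> y\<close> and \<open>x \<noteq> y\<close>.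
\<close>

definition dir_edges :: "'a rel \<Rightarrow> 'a set \<Rightarrow> ('a \<times> 'a) set" where
  "dir_edges r C = {(x, y). x \<in> C \<and> y \<in> C \<and> (x, y) \<in> r \<and> x \<noteq> y}"

text \<open>
  Indices are cyclic. For two vertices the two cyclic conditions coincide, as \<^term>\<open>comparable r\<close> is
  symmetric, so this is the single condition \<open>x\<^sub>1 \<sim> x\<^sub>2\<close>.
\<close>

definition circle :: "'a set \<Rightarrow> 'a rel \<Rightarrow> 'a list \<Rightarrow> bool" where
  "circle X r xs \<longleftrightarrow>
     length xs \<ge> 2 \<and> distinct xs \<and> set xs \<subseteq> X \<and>
     (\<forall>i < length xs. comparable r (xs ! i) (xs ! (Suc i mod length xs)))"

definition circle_contains :: "'a list \<Rightarrow> 'a \<times> 'a \<Rightarrow> bool" where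
  "circle_contains xs e \<longleftrightarrow>
     (\<exists>i < length xs. e = (xs ! i, xs ! (Suc i mod length xs)) \<or>
                      e = (xs ! (Suc i mod length xs), xs ! i))"

definition edge_equiv :: "'a set \<Rightarrow> 'a rel \<Rightarrow> (('a \<times> 'a) \<times> ('a \<times> 'a)) set" where
  "edge_equiv X r =
     {(e, e'). e \<in> dir_edges r X \<and> e' \<in> dir_edges r X \<and>
               (\<exists>xs. circle X r xs \<and> circle_contains xs e \<and> circle_contains xs e')}"

end

theory Submission
  imports Defs
begin

text \<open>
  Commutation with the idempotents \<open>matrix_unit x x\<close> forces a commuting map \<open>\<theta>\<close> to multiply the
  entry at an edge \<open>u \<sim> v\<close> by a coefficient \<open>h v v - h v u\<close>, where \<open>h x\<close> is the diagonal of
  \<open>\<theta> (matrix_unit x x)\<close> and is constant along edges avoiding \<open>x\<close>. Going around a circle without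
  passing through \<open>x\<close> shows that the two edges of the circle at \<open>x\<close> have the same coefficient. So if
  all edges of a component are equivalent, subtracting a central multiple leaves a commuting map with
  diagonal values, and these values are central.

  Conversely, two edges on no common circle are separated by a cut vertex \<open>y\<close>: grow a vertex set in
  which any two points are joined by a simple path through the first edge; once it is maximal, every
  branch outside it is attached at one vertex only. Multiplying the entries on one side of the cut by
  \<open>1\<close> and those on the other by \<open>0\<close> extends to a commuting map, and it is not proper.
\<close>

section \<open>Incidence algebras of finite pre-orders\<close>

locale finite_preorder =
  fixes X :: "'a set" and r :: "'a rel"
  assumes finite_X: "finite X" and preorder: "preorder_on X r"
begin

lemma r_subset: "(u, v) \<in> r \<Longrightarrow> u \<in> X \<and> v \<in> X"
  using preorder by (auto simp: preorder_on_def)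

lemma r_refl: "u \<in> X \<Longrightarrow> (u, u) \<in> r"
  using preorder by (auto simp: preorder_on_def refl_on_def)

lemma r_trans: "(u, v) \<in> r \<Longrightarrow> (v, w) \<in> r \<Longrightarrow> (u, w) \<in> r"
  using preorder by (auto simp: preorder_on_def elim: transE)

text \<open>Entries off \<open>r\<close> vanish, so every entry of a product is a sum over the fixed
  finite set \<open>X\<close>, and sums can be compared termwise without interval
  conditions.\<close>

lemma inc_mult_eq_sum:
  fixes f g :: "('a, 'r::comm_ring_1) incfun"
  assumes "f \<in> incidence_algebra r" "g \<in> incidence_algebra r"
  shows "inc_mult r f g (u, v) = (\<Sum>z\<in>X. f (u, z) * g (z, v))"
proof -
  have "f (u, z) * g (z, v) = 0" if "\<not> ((u, z) \<in> r \<and> (z, v) \<in> r)" for z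
    using assms that by (auto simp: incidence_algebra_def)
  then have "(\<Sum>z | (u, z) \<in> r \<and> (z, v) \<in> r. f (u, z) * g (z, v)) = (\<Sum>z\<in>X. f (u, z) * g (z, v))"
    using finite_X by (intro sum.mono_neutral_left) (auto dest: r_subset)
  then show ?thesis
    by (simp add: inc_mult_def)
qed

lemma inc_mult_in_algebra:
  "inc_mult r f g \<in> (incidence_algebra r :: ('a, 'r::comm_ring_1) incfun set)"
proof -
  have "{z. (u, z) \<in> r \<and> (z, v) \<in> r} = {}" if "(u, v) \<notin> r" for u v
    using that r_trans by blast
  then show ?thesis
    by (auto simp: incidence_algebra_def inc_mult_def simp del: Collect_empty_eq)
qed

lemma inc_mult_add_left: "inc_mult r (f + g) h = inc_mult r f h + inc_mult r g h"
  by (auto simp: inc_mult_def fun_eq_iff sum.distrib distrib_right)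

lemma inc_mult_add_right: "inc_mult r h (f + g) = inc_mult r h f + inc_mult r h g"
  by (auto simp: inc_mult_def fun_eq_iff sum.distrib distrib_left)

lemma inc_mult_scale_right: "inc_mult r h (inc_scale c f) = inc_scale c (inc_mult r h f)"
  by (auto simp: inc_mult_def inc_scale_def fun_eq_iff sum_distrib_left mult.left_commute)

lemma algebra_add:
  "f \<in> incidence_algebra r \<Longrightarrow> g \<in> incidence_algebra r \<Longrightarrow> f + g \<in> incidence_algebra r"
  by (auto simp: incidence_algebra_def)

lemma algebra_diff:
  "f \<in> incidence_algebra r \<Longrightarrow> g \<in> incidence_algebra r \<Longrightarrow> f - g \<in> incidence_algebra r"
  by (auto simp: incidence_algebra_def)

lemma algebra_scale: "f \<in> incidence_algebra r \<Longrightarrow> inc_scale c f \<in> incidence_algebra r"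
  by (auto simp: incidence_algebra_def inc_scale_def)

section \<open>Matrix units, diagonal elements and the center\<close>

definition matrix_unit :: "'a \<Rightarrow> 'a \<Rightarrow> ('a, 'r::comm_ring_1) incfun" where
  "matrix_unit u v = (\<lambda>p. if p = (u, v) then 1 else 0)"

lemma matrix_unit_in_algebra: "(u, v) \<in> r \<Longrightarrow> matrix_unit u v \<in> incidence_algebra r"
  by (auto simp: matrix_unit_def incidence_algebra_def)

lemma inc_mult_matrix_unit_right:
  assumes "h \<in> incidence_algebra r" "(x, y) \<in> r"
  shows "inc_mult r h (matrix_unit x y) (u, v) = (if v = y then h (u, x) else 0)"
proof -
  have "(\<Sum>z\<in>X. h (u, z) * matrix_unit x y (z, v)) = (\<Sum>z\<in>X. if z = x then (if v = y then h (u, x) else 0) else 0)"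
    by (intro sum.cong) (auto simp: matrix_unit_def)
  with assms r_subset[OF assms(2)] finite_X show ?thesis
    by (simp add: inc_mult_eq_sum matrix_unit_in_algebra)
qed

lemma inc_mult_matrix_unit_left:
  assumes "h \<in> incidence_algebra r" "(x, y) \<in> r"
  shows "inc_mult r (matrix_unit x y) h (u, v) = (if u = x then h (y, v) else 0)"
proof -
  have "(\<Sum>z\<in>X. matrix_unit x y (u, z) * h (z, v)) = (\<Sum>z\<in>X. if z = y then (if u = x then h (y, v) else 0) else 0)"
    by (intro sum.cong) (auto simp: matrix_unit_def)
  with assms r_subset[OF assms(2)] finite_X show ?thesis
    by (simp add: inc_mult_eq_sum matrix_unit_in_algebra)
qed

definition diagonal :: "('a, 'r::comm_ring_1) incfun \<Rightarrow> bool" where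
  "diagonal d \<longleftrightarrow> (\<forall>u v. u \<noteq> v \<longrightarrow> d (u, v) = 0)"

lemma inc_mult_diagonal_left:
  assumes "diagonal d" "d \<in> incidence_algebra r" "h \<in> incidence_algebra r"
  shows "inc_mult r d h (u, v) = d (u, u) * h (u, v)"
proof -
  have "(\<Sum>z\<in>X. d (u, z) * h (z, v)) = (\<Sum>z\<in>X. if z = u then d (u, u) * h (u, v) else 0)"
    using assms(1) by (intro sum.cong) (auto simp: diagonal_def)
  moreover have "h (u, v) = 0" if "u \<notin> X"
    using that r_subset assms(3) by (auto simp: incidence_algebra_def)
  ultimately show ?thesis
    using assms finite_X by (auto simp: inc_mult_eq_sum)
qed

lemma inc_mult_diagonal_right:
  assumes "diagonal d" "d \<in> incidence_algebra r" "h \<in> incidence_algebra r"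
  shows "inc_mult r h d (u, v) = h (u, v) * d (v, v)"
proof -
  have "(\<Sum>z\<in>X. h (u, z) * d (z, v)) = (\<Sum>z\<in>X. if z = v then h (u, v) * d (v, v) else 0)"
    using assms(1) by (intro sum.cong) (auto simp: diagonal_def)
  moreover have "h (u, v) = 0" if "v \<notin> X"
    using that r_subset assms(3) by (auto simp: incidence_algebra_def)
  ultimately show ?thesis
    using assms finite_X by (auto simp: inc_mult_eq_sum)
qed

text \<open>Commuting with \<open>matrix_unit v v\<close> kills the off-diagonal entries of column
  \<open>v\<close>; commuting with \<open>matrix_unit u v\<close> equates the diagonal values at
  \<open>u\<close> and \<open>v\<close>. Conversely, a diagonal \<open>f\<close> scales
  \<open>g (u, v)\<close> by \<open>f (u, u)\<close> from the left and by \<open>f (v, v)\<close>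
  from the right.\<close>

lemma center_iff:
  fixes f :: "('a, 'r::comm_ring_1) incfun"
  shows "f \<in> inc_center r \<longleftrightarrow>
    f \<in> incidence_algebra r \<and> diagonal f \<and> (\<forall>u v. (u, v) \<in> r \<longrightarrow> f (u, u) = f (v, v))"
proof
  assume f: "f \<in> inc_center r"
  then have alg: "f \<in> incidence_algebra r"
    by (simp add: inc_center_def)
  have comm: "inc_mult r f (matrix_unit u v) = inc_mult r (matrix_unit u v) f" if "(u, v) \<in> r" for u v
    using f that unfolding inc_center_def by (blast intro: matrix_unit_in_algebra)
  have off: "f (u, v) = 0" if "u \<noteq> v" for u v
  proof (cases "v \<in> X")
    case True
    from fun_cong[OF comm[OF r_refl[OF True]], of "(u, v)"] that alg r_refl[OF True] show ?thesis
      by (simp add: inc_mult_matrix_unit_left inc_mult_matrix_unit_right)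
  next
    case False
    then show ?thesis
      using alg r_subset by (auto simp: incidence_algebra_def)
  qed
  have "f (u, u) = f (v, v)" if "(u, v) \<in> r" for u v
    using fun_cong[OF comm[OF that], of "(u, v)"] that alg
    by (simp add: inc_mult_matrix_unit_left inc_mult_matrix_unit_right)
  with off alg show "f \<in> incidence_algebra r \<and> diagonal f \<and> (\<forall>u v. (u, v) \<in> r \<longrightarrow> f (u, u) = f (v, v))"
    by (auto simp: diagonal_def)
next
  assume f: "f \<in> incidence_algebra r \<and> diagonal f \<and> (\<forall>u v. (u, v) \<in> r \<longrightarrow> f (u, u) = f (v, v))"
  have "inc_mult r f g (u, v) = inc_mult r g f (u, v)" if "g \<in> incidence_algebra r" for g u v
  proof (cases "(u, v) \<in> r")
    case True
    then show ?thesis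
      using f that by (auto simp: inc_mult_diagonal_left inc_mult_diagonal_right mult.commute)
  next
    case False
    then show ?thesis
      using inc_mult_in_algebra[of f g] inc_mult_in_algebra[of g f] by (auto simp: incidence_algebra_def)
  qed
  with f show "f \<in> inc_center r"
    by (auto simp: inc_center_def)
qed

section \<open>Components\<close>

lemma comparable_sym: "comparable r u v \<Longrightarrow> comparable r v u"
  by (auto simp: comparable_def)

lemma comparable_in_X: "comparable r u v \<Longrightarrow> u \<in> X \<and> v \<in> X"
  using r_subset by (auto simp: comparable_def)

text \<open>Chains are not confined to a subset here, unlike in \<open>connected_subset\<close>.
  Comparable points lie in \<open>X\<close>, so outside \<open>X\<close> only reflexive pairs are
  added.\<close>

definition reach :: "'a rel" where
  "reach = {(u, v). comparable r u v}\<^sup>*"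

lemma reach_sym: "(u, v) \<in> reach \<Longrightarrow> (v, u) \<in> reach"
  unfolding reach_def by (rule symD[OF sym_rtrancl]) (auto intro: symI comparable_sym)

lemma comparable_reach: "comparable r u v \<Longrightarrow> (u, v) \<in> reach"
  by (auto simp: reach_def)

lemma reach_trans: "(u, v) \<in> reach \<Longrightarrow> (v, w) \<in> reach \<Longrightarrow> (u, w) \<in> reach"
  by (auto simp: reach_def)

lemma reach_in_X: "(u, v) \<in> reach \<Longrightarrow> u \<in> X \<Longrightarrow> v \<in> X"
  unfolding reach_def by (induction rule: rtrancl_induct) (auto dest: comparable_in_X)

lemma connected_subset_reach:
  assumes "connected_subset r C" "x \<in> C" "y \<in> C"
  shows "(x, y) \<in> reach"
  using assms rtrancl_mono[of "{(u, v). u \<in> C \<and> v \<in> C \<and> comparable r u v}" "{(u, v). comparable r u v}"]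
  unfolding connected_subset_def reach_def by blast

text \<open>A chain starting at \<open>x\<close> never leaves the class of \<open>x\<close>, so the
  class is connected within itself. A connected superset contains \<open>x\<close> and therefore
  lies in the class.\<close>

lemma reach_class_component:
  assumes "x \<in> X"
  shows "reach `` {x} \<in> connected_components X r"
proof -
  let ?C = "reach `` {x}"
  let ?R = "{(u, v). u \<in> ?C \<and> v \<in> ?C \<and> comparable r u v}"
  have x_to: "(x, y) \<in> ?R\<^sup>*" if "(x, y) \<in> reach" for y
    using that unfolding reach_def
  proof (induction rule: rtrancl_induct)
    case (step y z)
    then have "(x, z) \<in> {(u, v). comparable r u v}\<^sup>*"
      by (meson rtrancl.rtrancl_into_rtrancl)
    with step have "(y, z) \<in> ?R"
      by (auto simp: reach_def)
    with step.IH show ?case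
      unfolding reach_def by (rule rtrancl.rtrancl_into_rtrancl)
  qed auto
  have "sym (?R\<^sup>*)"
    by (intro sym_rtrancl symI) (auto intro: comparable_sym)
  with x_to have "connected_subset r ?C"
    unfolding connected_subset_def by (meson Image_singleton_iff rtrancl_trans symD)
  moreover have "?C \<subseteq> X"
    using assms reach_in_X by auto
  moreover have "D = ?C" if "?C \<subseteq> D" "connected_subset r D" for D
  proof -
    have "x \<in> ?C"
      by (simp add: reach_def)
    with that show ?thesis
      using connected_subset_reach[OF that(2)] by blast
  qed
  ultimately show ?thesis
    by (auto simp: connected_components_def)
qed

section \<open>Commuting maps\<close>

text \<open>Polarization: expand the commutation at \<open>f + g\<close> and cancel those at
  \<open>f\<close> and at \<open>g\<close>.\<close>

lemma commuting_linearized: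
  assumes \<theta>: "commuting_map r \<theta>" and "f \<in> incidence_algebra r" "g \<in> incidence_algebra r"
  shows "inc_mult r (\<theta> f) g + inc_mult r (\<theta> g) f = inc_mult r f (\<theta> g) + inc_mult r g (\<theta> f)"
proof -
  have comm: "inc_mult r (\<theta> h) h = inc_mult r h (\<theta> h)" if "h \<in> incidence_algebra r" for h
    using \<theta> that by (simp add: commuting_map_def inc_commutator_def)
  have "\<theta> (f + g) = \<theta> f + \<theta> g"
    using assms by (simp add: commuting_map_def inc_linear_def)
  then show ?thesis
    using comm[OF algebra_add[OF assms(2,3)]] comm[OF assms(2)] comm[OF assms(3)]
    by (simp add: inc_mult_add_left inc_mult_add_right algebra_simps)
qed

text \<open>For \<open>x = v\<close> the entry vanishes because
  \<open>\<theta> (matrix_unit v v)\<close> commutes with \<open>matrix_unit v v\<close>. For other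
  \<open>x\<close> it is isolated by the \<open>(u, v)\<close> entry of the polarized identity for
  \<open>matrix_unit v v\<close> and \<open>matrix_unit x x\<close>.\<close>

lemma commuting_matrix_unit_diagonal:
  assumes \<theta>: "commuting_map r \<theta>" and x: "x \<in> X"
  shows "diagonal (\<theta> (matrix_unit x x))"
  unfolding diagonal_def
proof (intro allI impI)
  fix u v :: 'a
  assume "u \<noteq> v"
  have alg: "\<theta> f \<in> incidence_algebra r" if "f \<in> incidence_algebra r" for f
    using \<theta> that by (auto simp: commuting_map_def inc_linear_def)
  show "\<theta> (matrix_unit x x) (u, v) = 0"
  proof (cases "v \<in> X")
    case True
    note [simp] = matrix_unit_in_algebra r_refl alg
    have "inc_mult r (\<theta> (matrix_unit v v)) (matrix_unit v v) = inc_mult r (matrix_unit v v) (\<theta> (matrix_unit v v))"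
      using \<theta> True by (simp add: commuting_map_def inc_commutator_def)
    from fun_cong[OF this, of "(u, v)"] have "\<theta> (matrix_unit v v) (u, v) = 0"
      using \<open>u \<noteq> v\<close> True by (simp add: inc_mult_matrix_unit_left inc_mult_matrix_unit_right)
    then show ?thesis
      using fun_cong[OF commuting_linearized[OF \<theta>, of "matrix_unit v v" "matrix_unit x x"], of "(u, v)"]
        \<open>u \<noteq> v\<close> True x
      by (auto simp: inc_mult_matrix_unit_left inc_mult_matrix_unit_right split: if_splits)
  next
    case False
    with alg[OF matrix_unit_in_algebra[OF r_refl[OF x]]] show ?thesis
      using r_subset by (auto simp: incidence_algebra_def)
  qed
qed

text \<open>This is the \<open>(u, v)\<close> entry of the polarized identity for \<open>f\<close>
  and \<open>matrix_unit x x\<close>. The signed factor is 1 for \<open>x = v\<close>, -1 for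
  \<open>x = u\<close> and 0 otherwise; the three cases give the coefficient of an edge, its
  symmetry, and the constancy of the diagonal along edges avoiding \<open>x\<close>.\<close>

lemma commuting_off_diagonal:
  assumes \<theta>: "commuting_map r \<theta>" and x: "x \<in> X" and f: "f \<in> incidence_algebra r" and "u \<noteq> v"
  shows "\<theta> f (u, v) * (of_bool (v = x) - of_bool (u = x)) =
    f (u, v) * (\<theta> (matrix_unit x x) (v, v) - \<theta> (matrix_unit x x) (u, u))"
proof -
  have alg: "\<theta> f \<in> incidence_algebra r" if "f \<in> incidence_algebra r" for f
    using \<theta> that by (auto simp: commuting_map_def inc_linear_def)
  note [simp] = matrix_unit_in_algebra r_refl alg commuting_matrix_unit_diagonal[OF \<theta>]
  show ?thesis
    using fun_cong[OF commuting_linearized[OF \<theta> f, of "matrix_unit x x"], of "(u, v)"] x f \<open>u \<noteq> v\<close>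
    by (auto simp: inc_mult_matrix_unit_left inc_mult_matrix_unit_right inc_mult_diagonal_left
        inc_mult_diagonal_right algebra_simps split: if_splits)
qed

section \<open>Edge coefficients and their constancy on circles\<close>

definition edge_coeff :: "(('a, 'r::comm_ring_1) incfun \<Rightarrow> ('a, 'r) incfun) \<Rightarrow> 'a \<Rightarrow> 'a \<Rightarrow> 'r" where
  "edge_coeff \<theta> u v = \<theta> (matrix_unit v v) (v, v) - \<theta> (matrix_unit v v) (u, u)"

lemma commuting_off_diagonal_coeff:
  assumes "commuting_map r \<theta>" "f \<in> incidence_algebra r" "(u, v) \<in> r" "u \<noteq> v"
  shows "\<theta> f (u, v) = f (u, v) * edge_coeff \<theta> u v"
  using commuting_off_diagonal[OF assms(1) _ assms(2,4), of v] assms(4) r_subset[OF assms(3)]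
  by (simp add: edge_coeff_def)

lemma edge_coeff_sym:
  assumes \<theta>: "commuting_map r \<theta>" and "comparable r u v" "u \<noteq> v"
  shows "edge_coeff \<theta> u v = edge_coeff \<theta> v u"
proof -
  have *: "edge_coeff \<theta> u v = edge_coeff \<theta> v u" if "(u, v) \<in> r" "u \<noteq> v" for u v
    using commuting_off_diagonal[OF \<theta> _ matrix_unit_in_algebra[OF that(1)] that(2), of u]
      commuting_off_diagonal_coeff[OF \<theta> matrix_unit_in_algebra[OF that(1)] that]
      that r_subset[OF that(1)]
    by (simp add: edge_coeff_def matrix_unit_def algebra_simps)
  show ?thesis
    using assms *[of u v] *[of v u] by (auto simp: comparable_def)
qed

lemma commuting_diagonal_adjacent:
  assumes \<theta>: "commuting_map r \<theta>" and "comparable r u v" "x \<in> X" "x \<noteq> u" "x \<noteq> v"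
  shows "\<theta> (matrix_unit x x) (u, u) = \<theta> (matrix_unit x x) (v, v)"
proof -
  have *: "\<theta> (matrix_unit x x) (u, u) = \<theta> (matrix_unit x x) (v, v)"
    if "(u, v) \<in> r" "u \<noteq> v" "x \<noteq> u" "x \<noteq> v" for u v
    using commuting_off_diagonal[OF \<theta> \<open>x \<in> X\<close> matrix_unit_in_algebra[OF that(1)] that(2)] that
    by (simp add: matrix_unit_def)
  show ?thesis
    using *[of u v] *[of v u] assms(2,4,5) unfolding comparable_def by metis
qed


text \<open>The walk starts at the successor of \<open>xs ! j\<close> and takes \<open>k\<close>
  steps. The bound on \<open>k\<close> stops it before it returns to \<open>xs ! j\<close>, so each
  step is along an edge avoiding that vertex.\<close>

lemma circle_commuting_diagonal:
  assumes \<theta>: "commuting_map r \<theta>" and xs: "circle X r xs" and j: "j < length xs"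
    and "Suc k < length xs"
  shows "\<theta> (matrix_unit (xs ! j) (xs ! j)) (xs ! ((j + Suc k) mod length xs), xs ! ((j + Suc k) mod length xs))
    = \<theta> (matrix_unit (xs ! j) (xs ! j)) (xs ! (Suc j mod length xs), xs ! (Suc j mod length xs))"
  using assms(4)
proof (induction k)
  case 0
  then show ?case by simp
next
  case (Suc k)
  let ?n = "length xs"
  have ne: "xs ! j \<noteq> xs ! ((j + i) mod ?n)" if "0 < i" "i < ?n" for i
  proof -
    have "(j + i) mod ?n \<noteq> j"
      using that j by (auto simp: mod_if)
    moreover have "(j + i) mod ?n < ?n"
      using j by (intro mod_less_divisor) linarith
    ultimately show ?thesis
      using xs j unfolding circle_def by (metis nth_eq_iff_index_eq)
  qed
  have "comparable r (xs ! ((j + Suc k) mod ?n)) (xs ! (Suc ((j + Suc k) mod ?n) mod ?n))"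
    using xs mod_less_divisor[of ?n "j + Suc k"] unfolding circle_def
    by (meson less_le_trans zero_less_numeral)
  then have "comparable r (xs ! ((j + Suc k) mod ?n)) (xs ! ((j + Suc (Suc k)) mod ?n))"
    by (simp add: mod_Suc_eq)
  moreover have "xs ! j \<in> X"
    using xs j by (auto simp: circle_def)
  ultimately show ?case
    using commuting_diagonal_adjacent[OF \<theta>] ne[of "Suc k"] ne[of "Suc (Suc k)"] Suc
    by (metis Suc_lessD zero_less_Suc)
qed

lemma circle_edge_coeff:
  assumes \<theta>: "commuting_map r \<theta>" and xs: "circle X r xs"
  obtains c where "\<And>u v. circle_contains xs (u, v) \<Longrightarrow> edge_coeff \<theta> u v = c"
proof -
  let ?n = "length xs"
  \<comment> \<open>\<open>g\<close> is defined for all natural numbers with cyclic indices, so its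
    constancy is a plain induction without a wrap-around case.\<close>
  define g where "g i = edge_coeff \<theta> (xs ! (i mod ?n)) (xs ! (Suc i mod ?n))" for i
  have n: "?n \<ge> 2" and "distinct xs"
    using xs by (auto simp: circle_def)
  have cmp: "comparable r (xs ! (i mod ?n)) (xs ! (Suc i mod ?n))" for i
  proof -
    have "comparable r (xs ! (i mod ?n)) (xs ! (Suc (i mod ?n) mod ?n))"
      using xs n mod_less_divisor[of ?n i] unfolding circle_def by (meson less_le_trans zero_less_numeral)
    then show ?thesis
      by (simp add: mod_Suc_eq)
  qed
  have ne: "xs ! (i mod ?n) \<noteq> xs ! (Suc i mod ?n)" for i
  proof -
    have "i mod ?n \<noteq> Suc i mod ?n"
      using n by (auto simp: mod_Suc)
    moreover have "i mod ?n < ?n" "Suc i mod ?n < ?n"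
      using n by (intro mod_less_divisor, linarith)+
    ultimately show ?thesis
      using \<open>distinct xs\<close> by (simp add: nth_eq_iff_index_eq)
  qed
  \<comment> \<open>Edges number \<open>i\<close> and \<open>Suc i\<close> meet at
    \<open>xs ! j\<close>. Walking \<open>?n - 2\<close> steps on from the successor of
    \<open>xs ! j\<close> ends at its predecessor, so both neighbours carry the same diagonal
    value.\<close>
  have step: "g (Suc i) = g i" for i
  proof -
    define j where "j = Suc i mod ?n"
    have j: "j < ?n"
      using n unfolding j_def by (intro mod_less_divisor) linarith
    have "(j + Suc (?n - 2)) mod ?n = (Suc i + Suc (?n - 2)) mod ?n"
      unfolding j_def by (rule mod_add_left_eq)
    also have "Suc i + Suc (?n - 2) = i + ?n"
      using n by simp
    finally have "(j + Suc (?n - 2)) mod ?n = i mod ?n"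
      by simp
    moreover have "Suc j mod ?n = Suc (Suc i) mod ?n"
      by (simp add: j_def mod_Suc_eq)
    ultimately have "\<theta> (matrix_unit (xs ! j) (xs ! j)) (xs ! (i mod ?n), xs ! (i mod ?n))
        = \<theta> (matrix_unit (xs ! j) (xs ! j)) (xs ! (Suc (Suc i) mod ?n), xs ! (Suc (Suc i) mod ?n))"
      using circle_commuting_diagonal[OF \<theta> xs j, of "?n - 2"] n by simp
    \<comment> \<open>Symmetry rewrites the coefficient of the second edge in terms of the matrix
      unit at the shared vertex \<open>xs ! j\<close>, which the first already uses.\<close>
    then show ?thesis
      using edge_coeff_sym[OF \<theta> cmp ne, of "Suc i"] by (simp add: g_def edge_coeff_def j_def)
  qed
  have const: "g i = g 0" for i
    by (induction i) (simp_all add: step)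
  have "edge_coeff \<theta> u v = g 0" if uv: "circle_contains xs (u, v)" for u v
  proof -
    obtain i where i: "i < ?n"
      "(u, v) = (xs ! i, xs ! (Suc i mod ?n)) \<or> (u, v) = (xs ! (Suc i mod ?n), xs ! i)"
      using uv by (auto simp: circle_contains_def)
    then have "edge_coeff \<theta> u v = g i"
      using edge_coeff_sym[OF \<theta> cmp ne, of i] by (auto simp: g_def)
    with const show ?thesis
      by simp
  qed
  then show thesis
    by (rule that)
qed

lemma edge_equiv_edge_coeff:
  assumes "commuting_map r \<theta>" "((u, v), (u', v')) \<in> edge_equiv X r"
  shows "edge_coeff \<theta> u v = edge_coeff \<theta> u' v'"
proof -
  obtain xs where xs: "circle X r xs" "circle_contains xs (u, v)" "circle_contains xs (u', v')"
    using assms(2) by (auto simp: edge_equiv_def)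
  obtain c where "\<And>u v. circle_contains xs (u, v) \<Longrightarrow> edge_coeff \<theta> u v = c"
    using circle_edge_coeff[OF assms(1) xs(1)] by metis
  with xs show ?thesis
    by simp
qed

text \<open>Commutation at \<open>(u, v)\<close> only says that \<open>f (u, v)\<close> times the
  difference of the two diagonal values is zero. Since \<open>f (u, v)\<close> need not be
  cancellable, the equality is first obtained where this entry is 1 and then transferred by
  linearity.\<close>

lemma commuting_zero_off_diagonal_central:
  fixes f :: "('a, 'r::comm_ring_1) incfun"
  assumes "inc_linear r \<mu>"
    and comm: "\<And>f. f \<in> incidence_algebra r \<Longrightarrow> inc_mult r (\<mu> f) f = inc_mult r f (\<mu> f)"
    and diag: "\<And>f. f \<in> incidence_algebra r \<Longrightarrow> diagonal (\<mu> f)"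
    and f: "f \<in> incidence_algebra r"
  shows "\<mu> f \<in> inc_center r"
proof -
  have alg: "\<mu> g \<in> incidence_algebra r" if "g \<in> incidence_algebra r" for g
    using assms(1) that by (auto simp: inc_linear_def)
  have "\<mu> f (u, u) = \<mu> f (v, v)" if uv: "(u, v) \<in> r" "u \<noteq> v" for u v
  proof -
    have *: "\<mu> g (u, u) = \<mu> g (v, v)" if g: "g \<in> incidence_algebra r" "g (u, v) = 1" for g
      using fun_cong[OF comm[OF g(1)], of "(u, v)"] g diag[OF g(1)] alg[OF g(1)]
      by (simp add: inc_mult_diagonal_left inc_mult_diagonal_right)
    \<comment> \<open>\<open>f\<close> is a combination of \<open>matrix_unit u v\<close> and a function with value \<open>1\<close> at \<open>(u, v)\<close>.\<close>
    let ?e = "inc_scale (1 - f (u, v)) (matrix_unit u v)"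
    have e: "(matrix_unit u v :: ('a, 'r) incfun) \<in> incidence_algebra r"
      by (rule matrix_unit_in_algebra[OF uv(1)])
    have "\<mu> (f + ?e) = \<mu> f + inc_scale (1 - f (u, v)) (\<mu> (matrix_unit u v))"
      using assms(1) f e algebra_scale[OF e] by (simp add: inc_linear_def)
    moreover have "\<mu> (f + ?e) (u, u) = \<mu> (f + ?e) (v, v)"
      using * algebra_add[OF f algebra_scale[OF e]] by (simp add: inc_scale_def matrix_unit_def)
    moreover have "\<mu> (matrix_unit u v) (u, u) = \<mu> (matrix_unit u v) (v, v)"
      by (rule *[OF e]) (simp add: matrix_unit_def)
    ultimately show ?thesis
      by (simp add: inc_scale_def)
  qed
  then show ?thesis
    unfolding center_iff using alg[OF f] diag[OF f] by metis
qed

lemma commuting_imp_proper: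
  fixes \<theta> :: "('a, 'r::comm_ring_1) incfun \<Rightarrow> ('a, 'r) incfun"
  assumes \<theta>: "commuting_map r \<theta>"
    and equiv: "\<And>C e e'. C \<in> connected_components X r \<Longrightarrow> e \<in> dir_edges r C \<Longrightarrow> e' \<in> dir_edges r C
      \<Longrightarrow> (e, e') \<in> edge_equiv X r"
  shows "proper_map r \<theta>"
proof -
  have lin: "inc_linear r \<theta>"
    using \<theta> by (simp add: commuting_map_def)
  have comm: "inc_mult r (\<theta> f) f = inc_mult r f (\<theta> f)" if "f \<in> incidence_algebra r" for f
    using \<theta> that by (auto simp: commuting_map_def inc_commutator_def)
  define edges where "edges x = dir_edges r (reach `` {x})" for x
  define l where "l = (\<lambda>(x, y). if x = y \<and> x \<in> X then case_prod (edge_coeff \<theta>) (SOME e. e \<in> edges x) else 0)"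
  \<comment> \<open>At a vertex without edges the value of \<open>l\<close> is arbitrary, and every value is central there.\<close>
  have l_alg: "l \<in> incidence_algebra r" and l_diag: "diagonal l"
    using r_refl by (auto simp: incidence_algebra_def diagonal_def l_def)
  \<comment> \<open>Points of one component have the same set \<open>edges\<close>, so
    \<open>SOME\<close> picks literally the same edge for them.\<close>
  have l_const: "l (u, u) = l (v, v)" if "(u, v) \<in> r" for u v
  proof -
    have "(u, v) \<in> reach"
      using that by (simp add: comparable_reach comparable_def)
    then have "reach `` {u} = reach `` {v}"
      by (auto intro: reach_trans reach_sym)
    then show ?thesis
      using r_subset[OF that] by (simp add: l_def edges_def)
  qed
  have l_central: "l \<in> inc_center r"
    using l_alg l_diag l_const by (auto simp: center_iff)
  \<comment> \<open>Here the equivalence of edges enters: whichever edge was chosen, it has the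
    coefficient of \<open>(u, v)\<close>.\<close>
  have l_edge: "l (u, u) = edge_coeff \<theta> u v" if uv: "(u, v) \<in> r" "u \<noteq> v" for u v
  proof -
    have "u \<in> X"
      using r_subset uv by blast
    have "(u, v) \<in> edges u"
      using uv by (auto simp: edges_def dir_edges_def comparable_reach comparable_def) (simp add: reach_def)
    moreover from this have "(SOME e. e \<in> edges u) \<in> edges u"
      by (rule someI)
    ultimately have "((SOME e. e \<in> edges u), (u, v)) \<in> edge_equiv X r"
      using equiv[OF reach_class_component[OF \<open>u \<in> X\<close>]] by (simp add: edges_def)
    then show ?thesis
      using edge_equiv_edge_coeff[OF \<theta>] \<open>u \<in> X\<close>
      by (cases "SOME e. e \<in> edges u") (simp add: l_def)
  qed
  define \<mu> where "\<mu> f = \<theta> f - inc_mult r l f" for f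
  have lin_\<mu>: "inc_linear r \<mu>"
    unfolding inc_linear_def
  proof (intro conjI ballI allI)
    show "\<mu> \<in> incidence_algebra r \<rightarrow> incidence_algebra r"
      using lin unfolding inc_linear_def \<mu>_def by (blast intro: algebra_diff inc_mult_in_algebra)
  next
    fix f g :: "('a, 'r) incfun" assume "f \<in> incidence_algebra r" "g \<in> incidence_algebra r"
    then show "\<mu> (f + g) = \<mu> f + \<mu> g"
      using lin by (simp add: inc_linear_def \<mu>_def inc_mult_add_right)
  next
    fix c and f :: "('a, 'r) incfun" assume "f \<in> incidence_algebra r"
    then show "\<mu> (inc_scale c f) = inc_scale c (\<mu> f)"
      using lin unfolding inc_linear_def \<mu>_def inc_mult_scale_right
      by (simp add: inc_scale_def fun_eq_iff right_diff_distrib)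
  qed
  then have \<mu>_alg: "\<mu> f \<in> incidence_algebra r" if "f \<in> incidence_algebra r" for f
    using that by (auto simp: inc_linear_def)
  have \<theta>_eq: "\<theta> f = inc_mult r l f + \<mu> f" for f
    by (simp add: \<mu>_def)
  have diag: "diagonal (\<mu> f)" if f: "f \<in> incidence_algebra r" for f
  proof -
    have "\<mu> f (u, v) = 0" if "u \<noteq> v" for u v
    proof (cases "(u, v) \<in> r")
      case True
      then show ?thesis
        using commuting_off_diagonal_coeff[OF \<theta> f True that] l_edge[OF True that]
        by (simp add: \<mu>_def inc_mult_diagonal_left l_diag l_alg f)
    next
      case False
      then show ?thesis
        using \<mu>_alg[OF f] by (simp add: incidence_algebra_def)
    qed
    then show ?thesis
      by (simp add: diagonal_def)
  qed
  \<comment> \<open>A term with \<open>f (u, z)\<close> nonzero has \<open>(u, z)\<close> in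
    \<open>r\<close>, where the diagonal values of \<open>l\<close> agree.\<close>
  have "inc_mult r (inc_mult r l f) f = inc_mult r f (inc_mult r l f)" if f: "f \<in> incidence_algebra r" for f
  proof -
    have "(\<Sum>z\<in>X. l (u, u) * f (u, z) * f (z, v)) = (\<Sum>z\<in>X. f (u, z) * (l (z, z) * f (z, v)))" for u v
    proof (intro sum.cong refl)
      fix z
      show "l (u, u) * f (u, z) * f (z, v) = f (u, z) * (l (z, z) * f (z, v))"
        using f l_const[of u z] by (cases "(u, z) \<in> r") (auto simp: incidence_algebra_def)
    qed
    then show ?thesis
      by (auto simp: fun_eq_iff inc_mult_eq_sum[OF inc_mult_in_algebra f] inc_mult_eq_sum[OF f inc_mult_in_algebra]
          inc_mult_diagonal_left l_diag l_alg f)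
  qed
  with comm have "inc_mult r (\<mu> f) f = inc_mult r f (\<mu> f)" if "f \<in> incidence_algebra r" for f
    using that by (metis \<theta>_eq add_left_cancel inc_mult_add_left inc_mult_add_right)
  then have "\<mu> f \<in> inc_center r" if "f \<in> incidence_algebra r" for f
    using commuting_zero_off_diagonal_central[OF lin_\<mu>] diag that by blast
  then show ?thesis
    unfolding proper_map_def using l_central lin_\<mu> \<theta>_eq by blast
qed

section \<open>Cut vertices\<close>

definition path :: "'a list \<Rightarrow> bool" where
  "path xs \<longleftrightarrow> distinct xs \<and> successively (comparable r) xs"

lemma path_Nil [simp]: "path []" and path_singleton [simp]: "path [x]"
  by (simp_all add: path_def)

lemma path_rev: "path (rev xs) \<longleftrightarrow> path xs"
  using comparable_sym by (auto simp: path_def intro: successively_mono)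

lemma path_append_iff:
  "path (xs @ ys) \<longleftrightarrow> path xs \<and> path ys \<and> set xs \<inter> set ys = {} \<and>
    (xs \<noteq> [] \<longrightarrow> ys \<noteq> [] \<longrightarrow> comparable r (last xs) (hd ys))"
  by (auto simp: path_def successively_append_iff)

text \<open>Loops are erased as the chain grows: on reaching a vertex already visited, the path is
  cut back to that visit.\<close>

lemma reachable_path:
  assumes "(u, v) \<in> {(x, y). x \<in> S \<and> y \<in> S \<and> comparable r x y}\<^sup>*" "u \<in> S"
  shows "\<exists>xs. xs \<noteq> [] \<and> path xs \<and> set xs \<subseteq> S \<and> hd xs = u \<and> last xs = v"
  using assms(1)
proof (induction rule: rtrancl_induct)
  case base
  then show ?case
    using assms(2) by (intro exI[of _ "[u]"]) (auto simp: path_def)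
next
  case (step y z)
  then obtain xs where xs: "xs \<noteq> []" "path xs" "set xs \<subseteq> S" "hd xs = u" "last xs = y"
    by blast
  show ?case
  proof (cases "z \<in> set xs")
    case True
    then obtain us vs where "xs = us @ z # vs"
      by (auto dest: split_list)
    then have "xs = (us @ [z]) @ vs"
      by simp
    with xs show ?thesis
      by (intro exI[of _ "us @ [z]"]) (auto simp: path_append_iff hd_append)
  next
    case False
    with xs step show ?thesis
      by (intro exI[of _ "xs @ [z]"]) (auto simp: path_append_iff)
  qed
qed

text \<open>An edge joining \<open>p\<close> and \<open>q\<close> closes such a path to a circle
  through both edges. Either direction of \<open>a\<close>, \<open>b\<close> is allowed, so that
  paths can be reversed.\<close>

definition path_through :: "'a \<Rightarrow> 'a \<Rightarrow> 'a set \<Rightarrow> 'a \<Rightarrow> 'a \<Rightarrow> bool" where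
  "path_through a b V p q \<longleftrightarrow> (\<exists>xs. xs \<noteq> [] \<and> path xs \<and> set xs \<subseteq> V \<and> hd xs = p \<and> last xs = q \<and>
     (\<exists>us vs. xs = us @ [a, b] @ vs \<or> xs = us @ [b, a] @ vs))"

lemma path_through_sym:
  assumes "path_through a b V p q"
  shows "path_through a b V q p"
proof -
  obtain xs us vs where xs: "xs \<noteq> []" "path xs" "set xs \<subseteq> V" "hd xs = p" "last xs = q"
    "xs = us @ [a, b] @ vs \<or> xs = us @ [b, a] @ vs"
    using assms unfolding path_through_def by blast
  have "rev xs = rev vs @ [b, a] @ rev us \<or> rev xs = rev vs @ [a, b] @ rev us"
    using xs(6) by auto
  with xs show ?thesis
    unfolding path_through_def by (intro exI[of _ "rev xs"]) (auto simp: path_rev hd_rev last_rev)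
qed

text \<open>The added pieces avoid \<open>V\<close> and each other, so the concatenation stays
  simple. The endpoints are written so that an empty piece leaves \<open>p\<close> or
  \<open>q\<close> in place.\<close>

lemma path_through_extend:
  assumes "path_through a b V p q" "V \<subseteq> W"
    and ks: "path ks" "set ks \<subseteq> W - V" "ks \<noteq> [] \<Longrightarrow> comparable r (last ks) p"
    and ls: "path ls" "set ls \<subseteq> W - V" "ls \<noteq> [] \<Longrightarrow> comparable r q (hd ls)"
    and "set ks \<inter> set ls = {}"
  shows "path_through a b W (hd (ks @ [p])) (last (q # ls))"
proof -
  obtain xs us vs where xs: "xs \<noteq> []" "path xs" "set xs \<subseteq> V" "hd xs = p" "last xs = q"
    "xs = us @ [a, b] @ vs \<or> xs = us @ [b, a] @ vs"
    using assms unfolding path_through_def by blast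
  have "path (ks @ xs @ ls)"
    using xs(1-5) ks ls assms(9) by (auto simp: path_append_iff)
  moreover have "ks @ xs @ ls = (ks @ us) @ [a, b] @ (vs @ ls) \<or> ks @ xs @ ls = (ks @ us) @ [b, a] @ (vs @ ls)"
    using xs(6) by auto
  moreover have "hd (ks @ xs @ ls) = hd (ks @ [p])" "last (ks @ xs @ ls) = last (q # ls)"
    using xs by (auto simp: hd_append)
  moreover have "set (ks @ xs @ ls) \<subseteq> W" "ks @ xs @ ls \<noteq> []"
    using xs(1,3) ks ls assms(2) by auto
  ultimately show ?thesis
    unfolding path_through_def by blast
qed

text \<open>In a 2-connected graph any two vertices are joined by a simple path through a given
  edge; this form of the property is the one that ears extend directly.\<close>

definition block :: "'a \<Rightarrow> 'a \<Rightarrow> 'a set \<Rightarrow> bool" where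
  "block a b V \<longleftrightarrow> (\<forall>p\<in>V. \<forall>q\<in>V. p \<noteq> q \<longrightarrow> path_through a b V p q)"

text \<open>The path from \<open>p\<close> to \<open>q\<close> is extended along the ear \<open>ks\<close> at one end or at both, so that it never
  uses a vertex of the ear twice.\<close>

lemma block_add_ear:
  assumes V: "block a b V" and "p \<in> V" "q \<in> V" "p \<noteq> q"
    and ks: "path ks" "ks \<noteq> []" "set ks \<inter> V = {}" "comparable r p (hd ks)" "comparable r (last ks) q"
  shows "block a b (V \<union> set ks)"
proof -
  let ?W = "V \<union> set ks"
  have thr: "path_through a b V x y" if "x \<in> V" "y \<in> V" "x \<noteq> y" for x y
    using V that by (auto simp: block_def)
  have mixed: "path_through a b ?W u v" if u: "u \<in> V" and v: "v \<in> set ks" for u v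
  proof -
    obtain A B where AB: "ks = A @ v # B"
      using split_list[OF v] by blast
    \<comment> \<open>Cross \<open>V\<close> from \<open>u\<close> to \<open>q\<close> and follow
      the ear backwards to \<open>v\<close>. If \<open>u = q\<close>, cross to \<open>p\<close>
      instead and follow the ear forwards.\<close>
    show ?thesis
    proof (cases "u = q")
      case False
      have "path (v # B)"
        using ks(1) AB by (simp add: path_append_iff)
      moreover have "comparable r q (last (v # B))"
        using ks(5) AB comparable_sym by simp
      ultimately have "path_through a b ?W (hd ([] @ [u])) (last (q # rev (v # B)))"
        using ks(3) AB
        by (intro path_through_extend[OF thr[OF u \<open>q \<in> V\<close> False]])
          (auto simp: path_rev hd_rev simp del: rev.simps)
      then show ?thesis
        by simp
    next
      case True
      have "ks = (A @ [v]) @ B"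
        by (simp add: AB)
      then have "path (A @ [v])" "comparable r p (hd (A @ [v]))"
        using ks(1,4) path_append_iff[of "A @ [v]" B] by (auto simp: hd_append)
      then have "path_through a b ?W (hd ([] @ [u])) (last (p # (A @ [v])))"
        using ks(3) AB True \<open>p \<noteq> q\<close> \<open>p \<in> V\<close> u
        by (intro path_through_extend[OF thr]) auto
      then show ?thesis
        by simp
    qed
  qed
  \<comment> \<open>Go from \<open>u\<close> back to \<open>p\<close>, cross \<open>V\<close> to
    \<open>q\<close>, and return along the ear to \<open>v\<close>; the stretch \<open>B\<close>
    between them is left out.\<close>
  have ear: "path_through a b ?W u v" if "ks = A @ u # B @ v # C" for u v A B C
  proof -
    have ks': "ks = (A @ [u]) @ B @ (v # C)"
      using that by simp
    then have "path (A @ [u])" "path (v # C)" "set (A @ [u]) \<inter> set (v # C) = {}"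
      using ks(1) unfolding ks' path_append_iff by auto
    moreover have "comparable r (hd (A @ [u])) p" "comparable r q (last (v # C))"
      using ks(4,5) comparable_sym unfolding ks' by (auto simp: hd_append)
    ultimately have "path_through a b ?W (hd (rev (A @ [u]) @ [p])) (last (q # rev (v # C)))"
      using ks(3) that
      by (intro path_through_extend[OF thr[OF \<open>p \<in> V\<close> \<open>q \<in> V\<close> \<open>p \<noteq> q\<close>]])
        (auto simp: path_rev hd_rev last_rev simp del: rev.simps rev_append)
    then show ?thesis
      by simp
  qed
  have both: "path_through a b ?W u v" if u: "u \<in> set ks" and v: "v \<in> set ks" and "u \<noteq> v" for u v
  proof -
    obtain A B where AB: "ks = A @ u # B"
      using split_list[OF u] by blast
    with v \<open>u \<noteq> v\<close> have "v \<in> set A \<or> v \<in> set B"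
      by auto
    then show ?thesis
    proof
      assume "v \<in> set B"
      then obtain C D where "B = C @ v # D"
        using split_list by metis
      with AB ear show ?thesis
        by blast
    next
      assume "v \<in> set A"
      then obtain C D where "A = C @ v # D"
        using split_list by metis
      then have "ks = C @ v # D @ u # B"
        using AB by simp
      with ear show ?thesis
        by (blast intro: path_through_sym)
    qed
  qed
  have "path_through a b ?W u v" if "u \<in> V" "v \<in> V" "u \<noteq> v" for u v
    using path_through_extend[OF thr[OF that], of ?W "[]" "[]"] by (auto simp: path_def)
  then show ?thesis
    unfolding block_def using mixed both by (blast intro: path_through_sym)
qed

text \<open>The closing edge sits at the last index, whose cyclic successor is 0. A path consisting
  of one edge yields a circle on two vertices.\<close>

lemma path_through_circle:
  assumes "path_through a b X p q" "p \<noteq> q" "comparable r p q"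
  shows "\<exists>xs. circle X r xs \<and> circle_contains xs (a, b) \<and> circle_contains xs (p, q)"
proof -
  obtain xs us vs where xs: "xs \<noteq> []" "path xs" "set xs \<subseteq> X" "hd xs = p" "last xs = q"
    "xs = us @ [a, b] @ vs \<or> xs = us @ [b, a] @ vs"
    using assms(1) unfolding path_through_def by blast
  let ?n = "length xs"
  have n: "?n \<ge> 2"
    using xs(6) by auto
  have pq: "xs ! (?n - 1) = q" "xs ! (Suc (?n - 1) mod ?n) = p"
    using xs(1,4,5) by (auto simp: last_conv_nth hd_conv_nth)
  have "comparable r (xs ! i) (xs ! (Suc i mod ?n))" if "i < ?n" for i
  proof (cases "Suc i < ?n")
    case True
    then show ?thesis
      using xs(2) by (simp add: path_def successively_conv_nth)
  next
    case False
    then have "i = ?n - 1"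
      using that by linarith
    then show ?thesis
      using pq assms(3) comparable_sym by simp
  qed
  then have "circle X r xs"
    using n xs by (auto simp: circle_def path_def)
  moreover have "circle_contains xs (p, q)"
    unfolding circle_contains_def using pq n by (intro exI[of _ "?n - 1"]) auto
  moreover have "circle_contains xs (a, b)"
    unfolding circle_contains_def using xs(6) by (intro exI[of _ "length us"]) (auto simp: nth_append)
  ultimately show ?thesis
    by blast
qed

text \<open>\<open>V\<close> is a maximal block, \<open>K\<close> the branch outside it containing
  an end of the second edge, and \<open>y\<close> the only point of \<open>V\<close> where
  \<open>K\<close> can be attached.\<close>

lemma cut_vertex_of_edges:
  assumes ab: "comparable r a b" "a \<noteq> b" and cd: "comparable r c d" "c \<noteq> d"
    and no_circle: "\<nexists>xs. circle X r xs \<and> circle_contains xs (a, b) \<and> circle_contains xs (c, d)"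
  shows "\<exists>K y. a \<notin> K \<and> b \<notin> K \<and> (c \<in> K \<or> d \<in> K) \<and> y \<notin> K \<and>
    (\<forall>u\<in>K. \<forall>v. comparable r u v \<longrightarrow> v \<in> K \<or> v = y)"
proof -
  define F where "F = {V. {a, b} \<subseteq> V \<and> V \<subseteq> X \<and> block a b V}"
  have "path_through a b {a, b} a b"
    unfolding path_through_def using ab by (intro exI[of _ "[a, b]"]) (auto simp: path_def)
  then have "block a b {a, b}"
    by (auto simp: block_def intro: path_through_sym)
  then have "{a, b} \<in> F"
    using comparable_in_X[OF ab(1)] by (simp add: F_def)
  moreover have "finite F"
    by (rule finite_subset[of _ "Pow X"]) (auto simp: F_def finite_X)
  ultimately obtain V where V: "V \<in> F" and max: "\<And>W. W \<in> F \<Longrightarrow> V \<subseteq> W \<Longrightarrow> W = V"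
    using finite_has_maximal[of F] by blast
  have blockV: "block a b V" and VX: "V \<subseteq> X" and abV: "a \<in> V" "b \<in> V"
    using V by (auto simp: F_def)
  have "\<not> (c \<in> V \<and> d \<in> V)"
  proof
    assume "c \<in> V \<and> d \<in> V"
    then have "path_through a b V c d"
      using blockV cd(2) by (auto simp: block_def)
    then have "path_through a b X c d"
      using VX unfolding path_through_def by blast
    with path_through_circle[OF this cd(2,1)] no_circle show False
      by blast
  qed
  then obtain w where w: "w = c \<or> w = d" "w \<notin> V"
    by blast
  let ?R = "{(x, y). x \<in> X - V \<and> y \<in> X - V \<and> comparable r x y}"
  define K where "K = ?R\<^sup>* `` {w}"
  have wX: "w \<in> X"
    using w comparable_in_X[OF cd(1)] by auto
  have wK: "w \<in> K"
    by (simp add: K_def)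
  have K_sub: "v \<in> X - V" if "v \<in> K" for v
    using that unfolding K_def Image_singleton_iff
    by (induction rule: rtrancl_induct) (use wX w in auto)
  have K_step: "v \<in> K \<or> v \<in> V" if "u \<in> K" "comparable r u v" for u v
  proof (rule disjCI)
    assume "v \<notin> V"
    then have "(u, v) \<in> ?R"
      using K_sub[OF that(1)] that(2) comparable_in_X[OF that(2)] by auto
    then show "v \<in> K"
      using that(1) unfolding K_def by (auto intro: rtrancl_into_rtrancl)
  qed
  have "sym (?R\<^sup>*)"
    by (intro sym_rtrancl symI) (auto intro: comparable_sym)
  then have K_conn: "(k, k') \<in> ?R\<^sup>*" if "k \<in> K" "k' \<in> K" for k k'
    using that unfolding K_def by (meson Image_singleton_iff rtrancl_trans symD)
  \<comment> \<open>With two attachment points, a path outside \<open>V\<close> from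
    \<open>k\<close> to \<open>k'\<close> would be an ear enlarging the maximal block.\<close>
  have attach: "p = q" if pq: "p \<in> V" "q \<in> V" "k \<in> K" "k' \<in> K" "comparable r k p" "comparable r k' q" for p q k k'
  proof (rule ccontr)
    assume "p \<noteq> q"
    obtain ks where ks: "ks \<noteq> []" "path ks" "set ks \<subseteq> X - V" "hd ks = k" "last ks = k'"
      using reachable_path[OF K_conn[OF pq(3,4)] K_sub[OF pq(3)]] by blast
    have "block a b (V \<union> set ks)"
      using ks that comparable_sym by (intro block_add_ear[OF blockV _ _ \<open>p \<noteq> q\<close>]) auto
    then have "V \<union> set ks = V"
      using ks V by (intro max) (auto simp: F_def)
    with ks(1,3) show False
      by (cases ks) auto
  qed
  obtain y where y: "y \<in> V" "\<And>u v. u \<in> K \<Longrightarrow> v \<in> V \<Longrightarrow> comparable r u v \<Longrightarrow> v = y"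
  proof (cases "\<exists>u\<in>K. \<exists>v\<in>V. comparable r u v")
    case True
    then show thesis
      using that attach by metis
  next
    case False
    \<comment> \<open>If \<open>K\<close> has no neighbour in \<open>V\<close>, the condition on
      \<open>y\<close> is vacuous and any point of \<open>V\<close> serves.\<close>
    then show thesis
      using that abV by metis
  qed
  have "y \<notin> K" "a \<notin> K" "b \<notin> K"
    using K_sub y abV by auto
  moreover have "c \<in> K \<or> d \<in> K"
    using w wK by auto
  moreover have "\<forall>u\<in>K. \<forall>v. comparable r u v \<longrightarrow> v \<in> K \<or> v = y"
    using K_step y(2) by metis
  ultimately show ?thesis
    by (intro exI[of _ K] exI[of _ y]) simp
qed

section \<open>Improper commuting maps\<close>

text \<open>Cut the graph at \<open>y\<close> and let \<open>K\<close> be a union of branches at \<open>y\<close>. This map keeps the part of \<open>f\<close>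
  supported on \<open>K \<union> {y}\<close>, and elsewhere it is the scalar \<open>f (y, y)\<close>.\<close>

definition cut_map :: "'a set \<Rightarrow> 'a \<Rightarrow> ('a, 'r::comm_ring_1) incfun \<Rightarrow> ('a, 'r) incfun" where
  "cut_map K y f = (\<lambda>(u, v). if (u, v) \<notin> r then 0 else if u \<in> K \<or> v \<in> K then f (u, v)
     else if u = v then f (y, y) else 0)"

lemma cut_map_in_algebra: "cut_map K y f \<in> incidence_algebra r"
  by (auto simp: cut_map_def incidence_algebra_def)

text \<open>Write \<open>f\<close> and its image as \<open>F\<close> and \<open>G\<close> plus the
  same scalar matrix with value \<open>f (y, y)\<close>. Scalars commute with everything, so it
  remains to compare \<open>G F\<close> with \<open>F G\<close>, which agree term by term.\<close>

lemma cut_map_commuting: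
  fixes K :: "'a set" and y :: 'a
  assumes y: "y \<notin> K" and cut: "\<And>u v. u \<in> K \<Longrightarrow> comparable r u v \<Longrightarrow> v \<in> K \<or> v = y"
  shows "commuting_map r (cut_map K y :: ('a, 'r::comm_ring_1) incfun \<Rightarrow> ('a, 'r) incfun)"
proof -
  let ?\<theta> = "cut_map K y :: ('a, 'r) incfun \<Rightarrow> ('a, 'r) incfun"
  have "inc_linear r ?\<theta>"
    using cut_map_in_algebra
    by (auto simp: inc_linear_def) (auto simp: cut_map_def inc_scale_def fun_eq_iff)
  moreover have "inc_mult r (?\<theta> f) f (u, v) = inc_mult r f (?\<theta> f) (u, v)"
    if f: "f \<in> incidence_algebra r" and uv: "(u, v) \<in> r" for f u v
  proof -
    define s where "s = f (y, y)"
    \<comment> \<open>\<open>I\<close> is 1 on the whole diagonal, also outside \<open>X\<close>;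
      hence the membership conditions in the identities for \<open>G\<close> and
      \<open>F\<close>.\<close>
    define I :: "'a \<Rightarrow> 'a \<Rightarrow> 'r" where "I x z = of_bool (x = z)" for x z
    define F where "F x z = f (x, z) - s * I x z" for x z
    define G where "G x z = (if x \<in> K \<or> z \<in> K then F x z else 0)" for x z
    have f_eq: "f (x, z) = F x z + s * I x z" for x z
      by (simp add: F_def)
    have \<theta>_eq: "?\<theta> f (x, z) = G x z + s * I x z" if "x \<in> X" "z \<in> X" for x z
      using that f r_refl by (auto simp: cut_map_def G_def F_def I_def s_def incidence_algebra_def)
    have F_outside: "F x z = 0" if "(x, z) \<notin> r" "x \<in> X" for x z
      using that f r_refl by (auto simp: F_def I_def incidence_algebra_def)
    have I_left: "(\<Sum>z\<in>X. I u z * H z) = H u" and I_right: "(\<Sum>z\<in>X. H z * I z v) = H v" for H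
    proof -
      have "(\<Sum>z\<in>X. I u z * H z) = (\<Sum>z\<in>X. if z = u then H u else 0)"
        "(\<Sum>z\<in>X. H z * I z v) = (\<Sum>z\<in>X. if z = v then H v else 0)"
        by (auto simp: I_def intro!: sum.cong)
      with r_subset[OF uv] finite_X
      show "(\<Sum>z\<in>X. I u z * H z) = H u" "(\<Sum>z\<in>X. H z * I z v) = H v"
        by simp_all
    qed
    have expand: "(\<Sum>z\<in>X. (A u z + s * I u z) * (B z v + s * I z v)) =
        (\<Sum>z\<in>X. A u z * B z v) + s * (A u v + B u v) + s * (s * I u v)" for A B
    proof -
      have "(\<Sum>z\<in>X. (A u z + s * I u z) * (B z v + s * I z v)) =
          (\<Sum>z\<in>X. A u z * B z v) + s * (\<Sum>z\<in>X. A u z * I z v)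
          + s * (\<Sum>z\<in>X. I u z * B z v) + s * (s * (\<Sum>z\<in>X. I u z * I z v))"
        unfolding sum_distrib_left sum.distrib[symmetric]
        by (intro sum.cong) (auto simp: algebra_simps)
      then show ?thesis
        unfolding I_left I_right by (simp add: distrib_left add.assoc)
    qed
    \<comment> \<open>The two factors of a term can lie on different sides of the cut only through \<open>F y y = 0\<close>.\<close>
    have "G u z * F z v = F u z * G z v" if z: "z \<in> X" for z
    proof (cases "(u, z) \<in> r \<and> (z, v) \<in> r")
      case True
      then have cmp: "comparable r u z" "comparable r z v" "comparable r u v"
        "comparable r z u" "comparable r v z" "comparable r v u"
        using uv by (auto simp: comparable_def)
      have "F y y = 0"
        by (simp add: F_def I_def s_def)
      \<comment> \<open>Both \<open>z\<close> and \<open>v\<close> are neighbours of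
        \<open>u\<close> outside \<open>K\<close>, so both are \<open>y\<close>.\<close>
      then have "F z v = 0" if "u \<in> K" "z \<notin> K" "v \<notin> K"
        using cut[of u z] cut[of u v] cmp that by metis
      moreover have "F u z = 0" if "v \<in> K" "z \<notin> K" "u \<notin> K"
        using cut[of v z] cut[of v u] cmp \<open>F y y = 0\<close> that by metis
      ultimately show ?thesis
        by (auto simp: G_def)
    next
      case False
      then show ?thesis
        using F_outside[of u z] F_outside[of z v] r_subset[OF uv] z by (auto simp: G_def)
    qed
    then have "(\<Sum>z\<in>X. G u z * F z v) = (\<Sum>z\<in>X. F u z * G z v)"
      by (rule sum.cong[OF refl])
    moreover have "inc_mult r (?\<theta> f) f (u, v) = (\<Sum>z\<in>X. (G u z + s * I u z) * (F z v + s * I z v))"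
      "inc_mult r f (?\<theta> f) (u, v) = (\<Sum>z\<in>X. (F u z + s * I u z) * (G z v + s * I z v))"
      using r_subset[OF uv]
      by (auto simp: inc_mult_eq_sum f cut_map_in_algebra \<theta>_eq f_eq[symmetric] intro!: sum.cong)
    ultimately show ?thesis
      by (simp add: expand add.commute)
  qed
  then have "inc_mult r (?\<theta> f) f (u, v) = inc_mult r f (?\<theta> f) (u, v)"
    if "f \<in> incidence_algebra r" for f u v
    using that inc_mult_in_algebra[of "?\<theta> f" f] inc_mult_in_algebra[of f "?\<theta> f"]
    by (cases "(u, v) \<in> r") (auto simp: incidence_algebra_def)
  ultimately show ?thesis
    by (auto simp: commuting_map_def inc_commutator_def fun_eq_iff)
qed

text \<open>A central summand is diagonal, so the off-diagonal coefficient comes from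
  \<open>l\<close> alone, and \<open>l\<close> is constant along chains of comparable
  points.\<close>

lemma proper_map_same_coeff:
  fixes \<theta> :: "('a, 'r::comm_ring_1) incfun \<Rightarrow> ('a, 'r) incfun"
  assumes proper: "proper_map r \<theta>" and ab: "(a, b) \<in> r" "a \<noteq> b" and cd: "(c, d) \<in> r" "c \<noteq> d"
    and "(a, c) \<in> reach"
  shows "\<theta> (matrix_unit a b) (a, b) = \<theta> (matrix_unit c d) (c, d)"
proof -
  obtain l \<mu> where l: "l \<in> inc_center r" and \<mu>: "\<mu> \<in> incidence_algebra r \<rightarrow> inc_center r"
    and eq: "\<forall>f\<in>incidence_algebra r. \<theta> f = inc_mult r l f + \<mu> f"
    using proper unfolding proper_map_def by blast
  have coeff: "\<theta> (matrix_unit u v) (u, v) = l (u, u)" if "(u, v) \<in> r" "u \<noteq> v" for u v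
  proof -
    have e: "(matrix_unit u v :: ('a, 'r) incfun) \<in> incidence_algebra r"
      by (rule matrix_unit_in_algebra[OF that(1)])
    then have "\<mu> (matrix_unit u v) \<in> inc_center r"
      using \<mu> by blast
    then have "\<mu> (matrix_unit u v) (u, v) = 0"
      using that(2) by (simp add: center_iff diagonal_def)
    with l show ?thesis
      using bspec[OF eq e] that(1) by (simp add: inc_mult_matrix_unit_right center_iff)
  qed
  have "l (a, a) = l (c, c)"
    using \<open>(a, c) \<in> reach\<close> unfolding reach_def
  proof (induction rule: rtrancl_induct)
    case (step y z)
    then show ?case
      using l by (auto simp: comparable_def center_iff)
  qed simp
  then show ?thesis
    using coeff ab cd by simp
qed

lemma proper_imp_edge_equiv:
  assumes proper: "\<And>\<theta> :: ('a, 'r::comm_ring_1) incfun \<Rightarrow> ('a, 'r) incfun.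
      commuting_map r \<theta> \<Longrightarrow> proper_map r \<theta>"
    and ab: "(a, b) \<in> r" "a \<noteq> b" and cd: "(c, d) \<in> r" "c \<noteq> d" and "(a, c) \<in> reach"
  shows "((a, b), (c, d)) \<in> edge_equiv X r"
proof (rule ccontr)
  assume "((a, b), (c, d)) \<notin> edge_equiv X r"
  then have no_circle: "\<nexists>xs. circle X r xs \<and> circle_contains xs (a, b) \<and> circle_contains xs (c, d)"
    using ab cd r_subset by (auto simp: edge_equiv_def dir_edges_def)
  have "comparable r a b" "comparable r c d"
    using ab cd by (auto simp: comparable_def)
  then obtain K y where K: "a \<notin> K" "b \<notin> K" "c \<in> K \<or> d \<in> K" "y \<notin> K"
    "\<forall>u\<in>K. \<forall>v. comparable r u v \<longrightarrow> v \<in> K \<or> v = y"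
    using cut_vertex_of_edges[OF _ ab(2) _ cd(2) no_circle] by blast
  let ?\<theta> = "cut_map K y :: ('a, 'r) incfun \<Rightarrow> ('a, 'r) incfun"
  have "proper_map r ?\<theta>"
    using K(4,5) by (intro proper cut_map_commuting) auto
  then have "?\<theta> (matrix_unit a b) (a, b) = ?\<theta> (matrix_unit c d) (c, d)"
    by (rule proper_map_same_coeff[OF _ ab cd \<open>(a, c) \<in> reach\<close>])
  \<comment> \<open>The entry at \<open>(a, b)\<close> is 0, since neither end lies in
    \<open>K\<close>; the one at \<open>(c, d)\<close> is 1, and 0 differs from 1 in the
    ring.\<close>
  then show False
    using K ab cd by (auto simp: cut_map_def matrix_unit_def)
qed

end

theorem theorem2p5:
  fixes X :: "'a set" and r :: "'a rel"
  assumes "finite X" and "preorder_on X r"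
    and two_torsion_free: "\<And>c::'r::comm_ring_1. 2 * c = 0 \<Longrightarrow> c = 0"
  shows "(\<forall>\<theta> :: ('a, 'r) incfun \<Rightarrow> ('a, 'r) incfun. commuting_map r \<theta> \<longrightarrow> proper_map r \<theta>) \<longleftrightarrow>
         (\<forall>X\<^sub>0 \<in> connected_components X r.
            \<forall>e \<in> dir_edges r X\<^sub>0. \<forall>e' \<in> dir_edges r X\<^sub>0. (e, e') \<in> edge_equiv X r)"
proof -
  interpret finite_preorder X r
    using assms(1,2) by unfold_locales
  show ?thesis
  proof (intro iffI ballI allI impI)
    fix X\<^sub>0 e e'
    assume proper: "\<forall>\<theta> :: ('a, 'r) incfun \<Rightarrow> ('a, 'r) incfun. commuting_map r \<theta> \<longrightarrow> proper_map r \<theta>"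
      and X\<^sub>0: "X\<^sub>0 \<in> connected_components X r" and "e \<in> dir_edges r X\<^sub>0" "e' \<in> dir_edges r X\<^sub>0"
    then obtain a b c d where e: "e = (a, b)" "e' = (c, d)" "(a, b) \<in> r" "a \<noteq> b" "(c, d) \<in> r" "c \<noteq> d"
      and "a \<in> X\<^sub>0" "c \<in> X\<^sub>0"
      by (auto simp: dir_edges_def)
    with X\<^sub>0 have "(a, c) \<in> reach"
      by (auto simp: connected_components_def intro: connected_subset_reach)
    with proper e show "(e, e') \<in> edge_equiv X r"
      using proper_imp_edge_equiv[where 'r = 'r] by simp
  next
    fix \<theta> :: "('a, 'r) incfun \<Rightarrow> ('a, 'r) incfun"
    assume "\<forall>X\<^sub>0 \<in> connected_components X r.
        \<forall>e \<in> dir_edges r X\<^sub>0. \<forall>e' \<in> dir_edges r X\<^sub>0. (e, e') \<in> edge_equiv X r"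
      and "commuting_map r \<theta>"
    then show "proper_map r \<theta>"
      by (intro commuting_imp_proper) auto
  qed
qed

end
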